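(* Let $\omega_0>0$ and $\epsilon\in\mathbb{C}$. Consider the dissipative Jaynes--Cummings master equation at zero temperature with a common reservoir, $$\dot\rho_S(t)=-\frac{i}{\hbar}[H_S,\rho_S(t)]+D(\rho_S(t)),\qquad H_S=\hbar\frac{\omega_0}{2}S_z+\hbar\omega_0\,\alpha^\dagger\alpha+\hbar\,(\epsilon\,\alpha S_++\epsilon^*\alpha^\dagger S_-),$$ $$\begin{aligned}D(\rho)=\;&\gamma^{1,1}\big(S_-\rho S_+-\tfrac12\{S_+S_-,\rho\}\big)+\gamma^{2,2}\big(\alpha\rho\alpha^\dagger-\tfrac12\{\alpha^\dagger\alpha,\rho\}\big)\\&+\gamma^{1,2}\big(\alpha\rho S_+-\tfrac12\{\alpha^\dagger S_-,\rho\}\big)+\gamma^{2,1}\big(S_-\rho\alpha^\dagger-\tfrac12\{S_+\alpha,\rho\}\big),\end{aligned}$$ with initial state $\rho_S(0)=|0,+\rangle\langle 0,+|$ (one excitation). Suppose that $\gamma^{1,1}=\gamma^{2,2}$ (the "Decoherence Free Regime"). Put $$|\psi_G\rangle=|0,-\rangle,\qquad |\psi_A\rangle=\frac{1}{\sqrt2}\big(|0,+\rangle-|1,-\rangle\big).$$ Then: (i) for $t\gg(\gamma^{1,1}+\gamma^{2,2})^{-1}$ the asymptotic form assumed by $\rho_S(t)$ is time independent, and the probability of finding energy in the bipartite system (atom + cavity mode) is $\frac12$: $$\rho_S\big(t\gg(\gamma^{1,1}+\gamma^{2,2})^{-1}\big)=\frac12|\psi_G\rangle\langle\psi_G|+\frac12|\psi_A\rangle\langle\psi_A|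 ;$$ (ii) suppose a single-photon detector continuously captures all the excitations lost by the system into the reservoir, and its state is read out at a time $t\gg(\gamma^{1,1}+\gamma^{2,2})^{-1}$. If no photon has been emitted, then as a consequence of this measurement outcome the atom--cavity system is projected into the maximally entangled antisymmetric state $|\psi_A\rangle$, and the bipartite system and the reservoir are left in an uncorrelated state.
   Context: The system is a two-level atom with orthonormal basis $|+\rangle$ (excited), $|-\rangle$ (ground), coupled to a single cavity mode with number states $|m\rangle$, $m=0,1,2,\dots$; $|m,\pm\rangle=|m\rangle\otimes|\pm\rangle$. The atomic operators are $S_+=|+\rangle\langle-|$, $S_-=|-\rangle\langle+|$, $S_z=|+\rangle\langle+|-|-\rangle\langle-|$; $\alpha,\alpha^\dagger$ are the annihilation and creation operators of the cavity mode ($\alpha|m\rangle=\sqrt m\,|m-1\rangle$). $\{X,Y\}=XY+YX$, and $\hbar>0$ is a constant. The master equation describes the reduced dynamics (Lamb shift neglected) of atom and mode both coupled to one common electromagnetic reservoir in its vacuum state, with bosonic modes $b_\lambda(\vec k)$ of frequency $\omega_{\vec k}$, through the interaction $\sum_{\vec k,\lambda}[g^*_{\vec k,\lambda}b_\lambda(\vec k)+g_{\vec k,\lambda}b^\dagger_\lambda(\vec k)](S_++S_-)+\sum_{\vec k,\lambda}[s^*_{\vec k,\lambda}b_\lambda(\vec k)+s_{\vec k,\lambda}b^\dagger_\lambda(\vec k)](\alpha^\dagger+\alpha)$. The coefficients are $\gamma^{1,1}=\pi\sum_{\vec k,\lambda}|g_{\vec k,\lambda}|^2\delta(\omega_{\vec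 k}-\omega)$, $\gamma^{2,2}=\pi\sum_{\vec k,\lambda}|s_{\vec k,\lambda}|^2\delta(\omega_{\vec k}-\omega)$, $\gamma^{1,2}=\pi\sum_{\vec k,\lambda}\mathrm{Re}(s^*_{\vec k,\lambda}g_{\vec k,\lambda})\delta(\omega_{\vec k}-\omega)+i\hbar\pi\sum_{\vec k,\lambda}\mathrm{Im}(s^*_{\vec k,\lambda}g_{\vec k,\lambda})\delta(\omega_{\vec k}-\omega)$, and $\gamma^{2,1}$ is the complex conjugate of $\gamma^{1,2}$; here $\omega$ is the frequency of the system transition at which the reservoir correlations are evaluated. With one initial excitation the solution has the form $\rho_S(t)=\rho_0(t)+\rho_1(t)$, with $\rho_1(t)$ supported on $\mathrm{span}\{|0,+\rangle,|1,-\rangle\}$ and $\rho_0(t)$ a multiple of $|0,-\rangle\langle0,-|$; $\rho_1(t)$ is the part of the mixture corresponding to no photon having been emitted into the reservoir up to time $t$.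
   Formalization: The formal theorem additionally assumes γ^{1,2} = √(γ^{1,1}γ^{2,2}) and that ε is real (and γ^{1,1}+γ^{2,2}>0); without the first two the claim fails, e.g. γ^{1,2}=0, or ε=i|ε|≠0 with γ^{1,2}=γ^{1,1}, where all energy decays. *)

theory Defs
  imports "HOL-Analysis.Analysis" "HOL-Library.Function_Algebras" "HOL-Library.Multiset"
    "HOL-Library.Nonpos_Ints"
begin

section \<open>Operators as matrices in an orthonormal basis\<close>

text \<open>
  A vector of the Hilbert space with orthonormal basis \<open>'a\<close> is given by its components, an operator
  by its matrix elements \<open>A i j = \<langle>i|A|j\<rangle>\<close>.  Addition and subtraction are pointwise; the operator
  product is \<open>\<cdot>\<close> (never \<open>*\<close>, which is pointwise).  The unbounded \<open>\<alpha>\<close>, \<open>\<alpha>\<^sup>\<dagger>\<close> and all other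
  operators below that get multiplied with states have finitely many nonzero elements in every row
  and column, so the sums defining these products are finite.
\<close>

type_synonym 'a vec_of = "'a \<Rightarrow> complex"
type_synonym 'a op = "'a \<Rightarrow> 'a \<Rightarrow> complex"

definition op_mult :: "'a op \<Rightarrow> 'a op \<Rightarrow> 'a op" (infixl "\<cdot>" 70) where
  "A \<cdot> B = (\<lambda>i j. \<Sum>\<^sub>\<infinity>k. A i k * B k j)"

definition op_scale :: "complex \<Rightarrow> 'a op \<Rightarrow> 'a op" (infixr "*\<^sub>C" 75) where
  "c *\<^sub>C A = (\<lambda>i j. c * A i j)"

definition op_id :: "'a op" where
  "op_id = (\<lambda>i j. of_bool (i = j))"

definition adj :: "'a op \<Rightarrow> 'a op" where
  "adj A = (\<lambda>i j. cnj (A j i))"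

definition ket :: "'a \<Rightarrow> 'a vec_of" where
  "ket i = (\<lambda>k. of_bool (k = i))"

definition ketbra :: "'a vec_of \<Rightarrow> 'a vec_of \<Rightarrow> 'a op" where
  "ketbra \<psi> \<phi> = (\<lambda>i j. \<psi> i * cnj (\<phi> j))"

abbreviation proj :: "'a vec_of \<Rightarrow> 'a op" where
  "proj \<psi> \<equiv> ketbra \<psi> \<psi>"

definition commutator :: "'a op \<Rightarrow> 'a op \<Rightarrow> 'a op" where
  "commutator A B = A \<cdot> B - B \<cdot> A"

definition anticommutator :: "'a op \<Rightarrow> 'a op \<Rightarrow> 'a op" where
  "anticommutator A B = A \<cdot> B + B \<cdot> A"

definition op_trace :: "'a op \<Rightarrow> complex" where
  "op_trace A = (\<Sum>\<^sub>\<infinity>i. A i i)"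

definition tensor :: "'a op \<Rightarrow> 'b op \<Rightarrow> ('a \<times> 'b) op" where
  "tensor A B = (\<lambda>(i, r) (j, s). A i j * B r s)"

definition ptrace_snd :: "('a \<times> 'b) op \<Rightarrow> 'a op" where
  "ptrace_snd X = (\<lambda>i j. \<Sum>\<^sub>\<infinity>r. X (i, r) (j, r))"

definition ptrace_fst :: "('a \<times> 'b) op \<Rightarrow> 'b op" where
  "ptrace_fst X = (\<lambda>r s. \<Sum>\<^sub>\<infinity>i. X (i, r) (i, s))"

text \<open>
  Positivity is tested on finitely supported vectors.  Together with the summable diagonal this
  characterizes the matrices of positive trace class operators of trace one.
\<close>

definition density_op :: "'a op \<Rightarrow> bool" where
  "density_op \<rho> \<longleftrightarrow>
     (\<forall>F v. finite F \<longrightarrow> (\<Sum>i\<in>F. \<Sum>j\<in>F. cnj (v i) * \<rho> i j * v j) \<in> \<real>\<^sub>\<ge>\<^sub>0) \<and>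
     ((\<lambda>i. \<rho> i i) has_sum 1) UNIV"

text \<open>
  The sum of the moduli of all matrix elements of \<open>A - B\<close> is an upper bound for the trace norm of
  \<open>A - B\<close>, because the matrix units have trace norm one.
\<close>

definition within_tolerance :: "real \<Rightarrow> 'a op \<Rightarrow> 'a op \<Rightarrow> bool" where
  "within_tolerance \<eta> A B \<longleftrightarrow>
     (\<lambda>(i, j). cmod (A i j - B i j)) summable_on UNIV \<and>
     (\<Sum>\<^sub>\<infinity>(i, j)\<in>UNIV. cmod (A i j - B i j)) < \<eta>"

definition uncorrelated :: "('a \<times> 'b) op \<Rightarrow> bool" where
  "uncorrelated X \<longleftrightarrow> X = tensor (ptrace_snd X) (ptrace_fst X)"


section \<open>Atom and cavity mode\<close>

datatype level = Excited | Ground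

text \<open>The basis state \<open>|m,\<plusminus>\<rangle>\<close> is indexed by \<open>(m, Excited)\<close>, \<open>(m, Ground)\<close>.\<close>

type_synonym jc = "nat \<times> level"

definition S_plus :: "jc op" where
  "S_plus = tensor op_id (ketbra (ket Excited) (ket Ground))"

definition S_minus :: "jc op" where
  "S_minus = tensor op_id (ketbra (ket Ground) (ket Excited))"

definition S_z :: "jc op" where
  "S_z = tensor op_id (proj (ket Excited) - proj (ket Ground))"

definition annih :: "jc op" where
  "annih = tensor (\<lambda>m n. if n = Suc m then complex_of_real (sqrt (real n)) else 0) op_id"

definition creat :: "jc op" where
  "creat = adj annih"

definition H_S :: "real \<Rightarrow> real \<Rightarrow> complex \<Rightarrow> jc op" where
  "H_S hbar \<omega>\<^sub>0 \<epsilon> =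
     complex_of_real (hbar * \<omega>\<^sub>0 / 2) *\<^sub>C S_z
     + complex_of_real (hbar * \<omega>\<^sub>0) *\<^sub>C (creat \<cdot> annih)
     + complex_of_real hbar *\<^sub>C (\<epsilon> *\<^sub>C (annih \<cdot> S_plus) + cnj \<epsilon> *\<^sub>C (creat \<cdot> S_minus))"

definition dissipator :: "complex \<Rightarrow> complex \<Rightarrow> complex \<Rightarrow> complex \<Rightarrow> jc op \<Rightarrow> jc op" where
  "dissipator \<gamma>11 \<gamma>22 \<gamma>12 \<gamma>21 \<rho> =
     \<gamma>11 *\<^sub>C (S_minus \<cdot> \<rho> \<cdot> S_plus - (1/2) *\<^sub>C anticommutator (S_plus \<cdot> S_minus) \<rho>)
     + \<gamma>22 *\<^sub>C (annih \<cdot> \<rho> \<cdot> creat - (1/2) *\<^sub>C anticommutator (creat \<cdot> annih) \<rho>)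
     + \<gamma>12 *\<^sub>C (annih \<cdot> \<rho> \<cdot> S_plus - (1/2) *\<^sub>C anticommutator (creat \<cdot> S_minus) \<rho>)
     + \<gamma>21 *\<^sub>C (S_minus \<cdot> \<rho> \<cdot> creat - (1/2) *\<^sub>C anticommutator (S_plus \<cdot> annih) \<rho>)"

definition generator ::
  "real \<Rightarrow> real \<Rightarrow> complex \<Rightarrow> real \<Rightarrow> real \<Rightarrow> complex \<Rightarrow> jc op \<Rightarrow> jc op" where
  "generator hbar \<omega>\<^sub>0 \<epsilon> \<gamma>11 \<gamma>22 \<gamma>12 \<rho> =
     (- \<i> / complex_of_real hbar) *\<^sub>C commutator (H_S hbar \<omega>\<^sub>0 \<epsilon>) \<rho>
     + dissipator (complex_of_real \<gamma>11) (complex_of_real \<gamma>22) \<gamma>12 (cnj \<gamma>12) \<rho>"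

text \<open>The master equation is required for every matrix element (one-sided derivative at time 0).\<close>

definition master_solution ::
  "real \<Rightarrow> real \<Rightarrow> complex \<Rightarrow> real \<Rightarrow> real \<Rightarrow> complex \<Rightarrow> (real \<Rightarrow> jc op) \<Rightarrow> bool" where
  "master_solution hbar \<omega>\<^sub>0 \<epsilon> \<gamma>11 \<gamma>22 \<gamma>12 \<rho> \<longleftrightarrow>
     (\<forall>t\<ge>0. density_op (\<rho> t)) \<and>
     (\<forall>t\<ge>0. \<forall>i j. ((\<lambda>u. \<rho> u i j) has_vector_derivative
         generator hbar \<omega>\<^sub>0 \<epsilon> \<gamma>11 \<gamma>22 \<gamma>12 (\<rho> t) i j) (at t within {0..}))"

definition \<psi>_G :: "jc vec_of" where
  "\<psi>_G = ket (0, Ground)"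

definition \<psi>_A :: "jc vec_of" where
  "\<psi>_A = (\<lambda>k. (ket (0, Excited) k - ket (1, Ground) k) / complex_of_real (sqrt 2))"

fun excitations :: "jc \<Rightarrow> nat" where
  "excitations (m, s) = m + (case s of Excited \<Rightarrow> 1 | Ground \<Rightarrow> 0)"

definition prob_energy :: "jc op \<Rightarrow> real" where
  "prob_energy \<rho> = (\<Sum>\<^sub>\<infinity>k\<in>{k. excitations k > 0}. Re (\<rho> k k))"

text \<open>\<open>\<rho>\<^sub>1\<close>: the part of the state on the span of \<open>|0,+\<rangle>\<close> and \<open>|1,-\<rangle>\<close>.\<close>

definition one_excitation_part :: "jc op \<Rightarrow> jc op" where
  "one_excitation_part \<rho> =
     (let P = proj (ket (0, Excited)) + proj (ket (1, Ground)) in P \<cdot> \<rho> \<cdot> P)"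

text \<open>A pure state is maximally entangled if the reduced state of the atom, the smaller of the two
  factors, is maximally mixed.\<close>

definition maximally_entangled :: "jc vec_of \<Rightarrow> bool" where
  "maximally_entangled \<psi> \<longleftrightarrow> ptrace_fst (proj \<psi>) = (1/2) *\<^sub>C op_id"

text \<open>Exchange of the excitations of atom and mode, the mode being restricted to the qubit spanned
  by its number states 0 and 1.\<close>

fun exchange :: "jc \<Rightarrow> jc" where
  "exchange (m, s) = ((case s of Excited \<Rightarrow> 1 | Ground \<Rightarrow> 0), (if m = 0 then Ground else Excited))"

definition antisymmetric :: "jc vec_of \<Rightarrow> bool" where
  "antisymmetric \<psi> \<longleftrightarrow>
     (\<forall>m s. m > 1 \<longrightarrow> \<psi> (m, s) = 0) \<and> (\<forall>m\<le>1. \<forall>s. \<psi> (exchange (m, s)) = - \<psi> (m, s))"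


section \<open>Reservoir\<close>

text \<open>
  \<open>\<Sum>\<^bsub>k,\<lambda>\<^esub> f(k,\<lambda>) \<delta>(\<omega>\<^sub>k - \<omega>)\<close> is read as the integral of \<open>f\<close> against a measure \<open>R\<close> on the set
  of reservoir modes (the mode density on the resonant shell \<open>\<omega>\<^sub>k = \<omega>\<close>).
\<close>

definition decay_rate :: "'m measure \<Rightarrow> ('m \<Rightarrow> complex) \<Rightarrow> real" where
  "decay_rate R f = pi * (\<integral>\<kappa>. (cmod (f \<kappa>))\<^sup>2 \<partial>R)"

definition cross_rate :: "real \<Rightarrow> 'm measure \<Rightarrow> ('m \<Rightarrow> complex) \<Rightarrow> ('m \<Rightarrow> complex) \<Rightarrow> complex" where
  "cross_rate hbar R g s =
     complex_of_real (pi * (\<integral>\<kappa>. Re (cnj (s \<kappa>) * g \<kappa>) \<partial>R))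
     + \<i> * complex_of_real (hbar * pi * (\<integral>\<kappa>. Im (cnj (s \<kappa>) * g \<kappa>) \<partial>R))"

text \<open>
  The reservoir Fock space has the occupation number basis indexed by \<open>'k multiset\<close>, where \<open>'k\<close>
  indexes an arbitrary orthonormal basis of the one-photon space (wave packets, so that no
  discreteness of the mode spectrum is implied).  The vacuum is \<open>{#}\<close>, the photon number \<open>size\<close>.

  Every excitation lost by atom and mode is a photon captured from the reservoir: the joint state
  lives on total excitation number one.
\<close>

definition captures_lost_excitations :: "(jc \<times> 'k multiset) op \<Rightarrow> bool" where
  "captures_lost_excitations X \<longleftrightarrow>
     (\<forall>i r j s. X (i, r) (j, s) \<noteq> 0 \<longrightarrow>
        excitations i + size r = 1 \<and> excitations j + size s = 1)"

definition no_photon :: "(jc \<times> 'k multiset) op" where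
  "no_photon = tensor op_id (proj (ket {#}))"

definition no_photon_part :: "(jc \<times> 'k multiset) op \<Rightarrow> (jc \<times> 'k multiset) op" where
  "no_photon_part X = no_photon \<cdot> X \<cdot> no_photon"

definition no_photon_prob :: "(jc \<times> 'k multiset) op \<Rightarrow> real" where
  "no_photon_prob X = Re (op_trace (no_photon_part X))"

definition no_photon_state :: "(jc \<times> 'k multiset) op \<Rightarrow> (jc \<times> 'k multiset) op" where
  "no_photon_state X = complex_of_real (1 / no_photon_prob X) *\<^sub>C no_photon_part X"


section \<open>Stationarity of the asymptotic state\<close>

definition asymptotic_state :: "jc op" where
  "asymptotic_state = (1/2) *\<^sub>C proj \<psi>_G + (1/2) *\<^sub>C proj \<psi>_A"

lemma jc_mult_supp_right: assumes "\<And>k j. k \<notin> {(0::nat, Ground), (0, Excited), (1, Ground)}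
  \<Longrightarrow> B k j = 0"
  shows "(A \<cdot> B) i j = A i (0,Ground) * B (0,Ground) j + A i (0,Excited) * B (0,Excited) j + A i
    (1,Ground) * B (1,Ground) j"
proof -
  have "(A \<cdot> B) i j = (\<Sum>\<^sub>\<infinity>k\<in>{(0::nat, Ground), (0, Excited), (1,
    Ground)}. A i k * B k j)"
    unfolding op_mult_def by (rule infsum_cong_neutral) (use assms in auto)
  then show ?thesis by simp
qed

lemma jc_mult_supp_left: assumes "\<And>k i. k \<notin> {(0::nat, Ground), (0, Excited), (1, Ground)}
  \<Longrightarrow> A i k = 0"
  shows "(A \<cdot> B) i j = A i (0,Ground) * B (0,Ground) j + A i (0,Excited) * B (0,Excited) j + A i
    (1,Ground) * B (1,Ground) j"
proof -
  have "(A \<cdot> B) i j = (\<Sum>\<^sub>\<infinity>k\<in>{(0::nat, Ground), (0, Excited), (1,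
    Ground)}. A i k * B k j)"
    unfolding op_mult_def by (rule infsum_cong_neutral) (use assms in auto)
  then show ?thesis by simp
qed

lemma asymptotic_state_elem: "asymptotic_state i j = (if i = (0,Ground) \<and> j = (0,Ground) then 1/2 else
   if i = (0,Excited) \<and> j = (0,Excited) then 1/4 else if i = (1,Ground) \<and> j = (1,Ground) then
     1/4 else
   if i = (0,Excited) \<and> j = (1,Ground) then -1/4 else if i = (1,Ground) \<and> j = (0,Excited) then
     -1/4 else 0)"
proof -
  have [simp]: "complex_of_real (sqrt 2) * complex_of_real (sqrt 2) = 2"
    by (simp flip: of_real_mult)
  show ?thesis by (auto simp: asymptotic_state_def op_scale_def ketbra_def \<psi>_G_def \<psi>_A_def
    ket_def)
qed

lemma asymptotic_state_supp: "k \<notin> {(0, Ground), (0, Excited), (1, Ground)} \<Longrightarrow>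
  asymptotic_state k j = 0" "k \<notin> {(0, Ground), (0, Excited), (1, Ground)} \<Longrightarrow>
  asymptotic_state j k = 0" by (auto simp: asymptotic_state_elem)

lemma op_mult_single: assumes "\<And>k. k \<noteq> c \<Longrightarrow> A i k = 0" shows "(A \<cdot> B) i
  j = A i c * B c j"
proof -
  have "(A \<cdot> B) i j = (\<Sum>\<^sub>\<infinity>k\<in>{c}. A i k * B k j)"
    unfolding op_mult_def by (rule infsum_cong_neutral) (use assms in auto)
  then show ?thesis by simp
qed

lemmas jc_op_defs = S_plus_def S_minus_def S_z_def annih_def creat_def adj_def tensor_def ketbra_def
  ket_def op_id_def

lemma S_plus_elem: "S_plus (m,a) (n,b) = of_bool (m = n \<and> a = Excited \<and> b = Ground)" by (auto
  simp: jc_op_defs)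

lemma S_minus_elem: "S_minus (m,a) (n,b) = of_bool (m = n \<and> a = Ground \<and> b = Excited)" by
  (auto simp: jc_op_defs)

lemma S_z_elem: "S_z (m,a) (n,b) = (if m = n \<and> a = b then if a = Excited then 1 else -1 else 0)"
  by (cases a; cases b; auto simp: jc_op_defs)

lemma annih_elem: "annih (m,a) (n,b) = (if n = Suc m \<and> a = b then complex_of_real (sqrt (real n))
  else 0)" by (auto simp: jc_op_defs)

lemma creat_elem: "creat (m,a) (n,b) = (if m = Suc n \<and> a = b then complex_of_real (sqrt (real m))
  else 0)" by (auto simp: jc_op_defs)

lemma annih_S_plus_elem: "(annih \<cdot> S_plus) (m,a) (n,b) = (if n = Suc m \<and> a = Excited \<and> b
  = Ground then complex_of_real (sqrt (real n)) else 0)"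
  by (subst op_mult_single[of "(Suc m,a)"]) (auto simp: annih_elem S_plus_elem split: if_splits)

lemma S_plus_annih_elem: "(S_plus \<cdot> annih) (m,a) (n,b) = (if n = Suc m \<and> a = Excited \<and> b
  = Ground then complex_of_real (sqrt (real n)) else 0)"
  by (subst op_mult_single[of "(m,Ground)"]) (auto simp: annih_elem S_plus_elem split: if_splits)

lemma creat_S_minus_elem: "(creat \<cdot> S_minus) (m,a) (n,b) = (if m = Suc n \<and> a = Ground \<and>
  b = Excited then complex_of_real (sqrt (real m)) else 0)"
  by (subst op_mult_single[of "(m-1,a)"]) (auto simp: creat_elem S_minus_elem split: if_splits)

lemma creat_annih_elem: "(creat \<cdot> annih) (m,a) (n,b) = (if m = n \<and> a = b then of_nat m else 0)"
  by (subst op_mult_single[of "(m-1,a)"]) (auto simp: creat_elem annih_elem simp flip: of_real_mult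
    split: if_splits)

lemma S_plus_S_minus_elem: "(S_plus \<cdot> S_minus) (m,a) (n,b) = of_bool (m = n \<and> a = Excited
  \<and> b = Excited)"
  by (subst op_mult_single[of "(m,Ground)"]) (auto simp: S_plus_elem S_minus_elem)

lemma generator_asymptotic_state_elem: "generator hbar w e g11 g22 g12 asymptotic_state i j = 
   (- \<i> / complex_of_real hbar) * ((H_S hbar w e \<cdot> asymptotic_state) i j - (asymptotic_state
     \<cdot> H_S hbar w e) i j)
  + complex_of_real g11 * ((S_minus \<cdot> asymptotic_state \<cdot> S_plus) i j - (1/2) * ((S_plus
    \<cdot> S_minus \<cdot> asymptotic_state) i j + (asymptotic_state \<cdot> (S_plus \<cdot> S_minus))
    i j))
  + complex_of_real g22 * ((annih \<cdot> asymptotic_state \<cdot> creat) i j - (1/2) * ((creat \<cdot>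
    annih \<cdot> asymptotic_state) i j + (asymptotic_state \<cdot> (creat \<cdot> annih)) i j))
  + g12 * ((annih \<cdot> asymptotic_state \<cdot> S_plus) i j - (1/2) * ((creat \<cdot> S_minus \<cdot>
    asymptotic_state) i j + (asymptotic_state \<cdot> (creat \<cdot> S_minus)) i j))
  + cnj g12 * ((S_minus \<cdot> asymptotic_state \<cdot> creat) i j - (1/2) * ((S_plus \<cdot> annih
    \<cdot> asymptotic_state) i j + (asymptotic_state \<cdot> (S_plus \<cdot> annih)) i j))"
  by (simp add: generator_def dissipator_def op_scale_def commutator_def anticommutator_def)

lemma mult_asymptotic_state_supp: "k \<notin> {(0, Ground), (0, Excited), (1, Ground)} \<Longrightarrow>
  (A \<cdot> asymptotic_state) i k = 0"
  using asymptotic_state_supp by (subst jc_mult_supp_right) auto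

lemma H_S_elem: "H_S hbar w e (m,a) (n,b) = (if m = n \<and> a = b then (if a = Excited then 1 else -1)
  * complex_of_real (hbar * w / 2) + complex_of_real (hbar * w) * of_nat m
  else if n = Suc m \<and> a = Excited \<and> b = Ground then hbar * e * complex_of_real (sqrt (real n))
  else if m = Suc n \<and> a = Ground \<and> b = Excited then hbar * cnj e * complex_of_real (sqrt (real
    m)) else 0)"
  by (auto simp: H_S_def op_scale_def S_z_elem creat_annih_elem annih_S_plus_elem creat_S_minus_elem)

lemma mult_asymptotic_state: "(A \<cdot> asymptotic_state) i j = A i (0,Ground) * asymptotic_state
  (0,Ground) j + A i (0,Excited) * asymptotic_state (0,Excited) j + A i (1,Ground) * asymptotic_state
  (1,Ground) j"
  by (rule jc_mult_supp_right) (use asymptotic_state_supp in auto)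

lemma asymptotic_state_mult: "(asymptotic_state \<cdot> B) i j = asymptotic_state i (0,Ground) * B
  (0,Ground) j + asymptotic_state i (0,Excited) * B (0,Excited) j + asymptotic_state i (1,Ground) * B
  (1,Ground) j"
  by (rule jc_mult_supp_left) (use asymptotic_state_supp in auto)

lemma mult_asymptotic_state_mult: "(A \<cdot> asymptotic_state \<cdot> B) i j = (A \<cdot>
  asymptotic_state) i (0,Ground) * B (0,Ground) j + (A \<cdot> asymptotic_state) i (0,Excited) * B
  (0,Excited) j + (A \<cdot> asymptotic_state) i (1,Ground) * B (1,Ground) j"
  by (rule jc_mult_supp_left) (use mult_asymptotic_state_supp in auto)

text \<open>
  If a solution converges elementwise to a constant matrix, that matrix is annihilated by the
  generator.  So, when the two decay rates agree, no solution converges to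
    \<open>asymptotic_state\<close> unless
  the cross rate equals them and \<open>\<epsilon>\<close> is real.
\<close>

lemma asymptotic_state_stationary_iff: assumes "hbar > 0"
  shows "generator hbar w e g g g12 asymptotic_state = 0 \<longleftrightarrow> g12 = complex_of_real g
    \<and> e \<in> \<real>"
proof -
  have A: "generator hbar w e g g g12 asymptotic_state i j = (
    if i = (0,Ground) \<and> j = (0,Ground) then (g - Re g12) / 2 else
    if i = (0,Excited) \<and> j = (0,Excited) then (\<i> * (e - cnj e) - g + Re g12) / 4 else
    if i = (1,Ground) \<and> j = (1,Ground) then (- \<i> * (e - cnj e) - g + Re g12) / 4 else
    if i = (0,Excited) \<and> j = (1,Ground) then (g - cnj g12) / 4 else
    if i = (1,Ground) \<and> j = (0,Excited) then (g - g12) / 4 else 0)" for i j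
  proof -
    obtain m a n b where ij: "i = (m,a)" "j = (n,b)" by fastforce
    have [simp]: "hbar \<noteq> 0" using assms by simp
    show ?thesis unfolding ij generator_asymptotic_state_elem mult_asymptotic_state
      asymptotic_state_mult mult_asymptotic_state_mult
      by (cases a; cases b; cases m; cases n; simp add: H_S_elem S_plus_elem S_minus_elem annih_elem
        creat_elem annih_S_plus_elem S_plus_annih_elem creat_S_minus_elem creat_annih_elem
        S_plus_S_minus_elem asymptotic_state_elem complex_eq_iff field_simps del: One_nat_def;
        auto simp: complex_eq_iff field_simps)
  qed
  show ?thesis
  proof
    assume "generator hbar w e g g g12 asymptotic_state = 0"
    then have Z: "generator hbar w e g g g12 asymptotic_state i j = 0" for i j by simp
    have "g - g12 = 0" using Z[of "(1,Ground)" "(0,Excited)"] unfolding A by simp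
    moreover from this have "e - cnj e = 0" using Z[of "(0,Excited)" "(0,Excited)"] unfolding A by auto
    ultimately show "g12 = complex_of_real g \<and> e \<in> \<real>" by (auto simp: complex_is_Real_iff
      complex_eq_iff)
  next
    assume "g12 = complex_of_real g \<and> e \<in> \<real>"
    then show "generator hbar w e g g g12 asymptotic_state = 0"
      by (intro ext) (auto simp: A Reals_cnj_iff complex_eq_iff)
  qed
qed

end

theory Submission
  imports Defs
begin

text \<open>
  The joint jump operator \<open>L = S\<^sub>- + \<alpha>\<close> only lowers the number of excitations, so the population
  of the levels with at most one excitation can only grow; as the trace is 1, a solution starting
  with one excitation stays supported on \<open>|0,-\<rangle>\<close>, \<open>|0,+\<rangle>\<close>, \<open>|1,-\<rangle>\<close>.  There, for real \<open>\<epsilon>\<close> and equal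
  rates \<open>\<gamma>\<close>, both \<open>H\<^sub>S\<close> and \<open>L\<^sup>\<dagger>L\<close> are diagonal in the symmetric and antisymmetric one-excitation
  states: the antisymmetric population is constant, the symmetric one decays like \<open>exp (-2\<gamma>t)\<close> and
  the coherences between them like \<open>exp (-\<gamma>t)\<close> in modulus.
\<close>

section \<open>Operator products that reduce to finite sums\<close>

lemma op_mult_sum:
  assumes "finite S" "\<And>k. k \<notin> S \<Longrightarrow> A i k * B k j = 0"
  shows "(A \<cdot> B) i j = (\<Sum>k\<in>S. A i k * B k j)"
proof -
  have "(A \<cdot> B) i j = (\<Sum>\<^sub>\<infinity>k\<in>S. A i k * B k j)"
    unfolding op_mult_def by (rule infsum_cong_neutral) (use assms in auto)
  then show ?thesis using assms by simp
qed

lemma op_mult_single_right: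
  assumes "\<And>k. k \<noteq> c \<Longrightarrow> B k j = 0"
  shows "(A \<cdot> B) i j = A i c * B c j"
  using op_mult_sum[of "{c}" A i B j] assms by simp

section \<open>Matrix elements of the generator\<close>

lemma S_minus_mult: "(S_minus \<cdot> B) (m,a) j = (if a = Ground then B (m,Excited) j else 0)"
  by (subst op_mult_single[of "(m,Excited)"]) (auto simp: S_minus_elem split: if_splits)

lemma mult_S_plus: "(A \<cdot> S_plus) i (n,b) = (if b = Ground then A i (n,Excited) else 0)"
  by (subst op_mult_single_right[of "(n,Excited)"]) (auto simp: S_plus_elem split: if_splits)

lemma annih_mult: "(annih \<cdot> B) (m,a) j = complex_of_real (sqrt (real (Suc m))) * B (Suc m,a) j"
  by (subst op_mult_single[of "(Suc m,a)"]) (auto simp: annih_elem split: if_splits)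

lemma mult_creat: "(A \<cdot> creat) i (n,b) = A i (Suc n,b) * complex_of_real (sqrt (real (Suc n)))"
  by (subst op_mult_single_right[of "(Suc n,b)"]) (auto simp: creat_elem split: if_splits)

lemma S_plus_S_minus_mult:
  "(S_plus \<cdot> S_minus \<cdot> B) (m,a) j = (if a = Excited then B (m,a) j else 0)"
  by (subst op_mult_single[of "(m,a)"]) (auto simp: S_plus_S_minus_elem split: if_splits)

lemma mult_S_plus_S_minus:
  "(A \<cdot> (S_plus \<cdot> S_minus)) i (n,b) = (if b = Excited then A i (n,b) else 0)"
  by (subst op_mult_single_right[of "(n,b)"]) (auto simp: S_plus_S_minus_elem split: if_splits)

lemma creat_annih_mult: "(creat \<cdot> annih \<cdot> B) (m,a) j = of_nat m * B (m,a) j"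
  by (subst op_mult_single[of "(m,a)"]) (auto simp: creat_annih_elem split: if_splits)

lemma mult_creat_annih: "(A \<cdot> (creat \<cdot> annih)) i (n,b) = A i (n,b) * of_nat n"
  by (subst op_mult_single_right[of "(n,b)"]) (auto simp: creat_annih_elem split: if_splits)

text \<open>At \<open>m = 0\<close> the truncated index \<open>m - 1\<close> would wrongly bring in
  the level |0,+>; the factor \<open>sqrt 0\<close> removes that term.
  \<open>mult_S_plus_annih\<close> and the rules for \<open>H_S\<close> rely on the same
  device.\<close>

lemma creat_S_minus_mult:
  "(creat \<cdot> S_minus \<cdot> B) (m,a) j =
     (if a = Ground then complex_of_real (sqrt (real m)) * B (m - 1,Excited) j else 0)"
  by (subst op_mult_single[of "(m - 1,Excited)"]) (cases m; auto simp: creat_S_minus_elem split: if_splits)+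

lemma mult_creat_S_minus:
  "(A \<cdot> (creat \<cdot> S_minus)) i (n,b) =
     (if b = Excited then A i (Suc n,Ground) * complex_of_real (sqrt (real (Suc n))) else 0)"
  by (subst op_mult_single_right[of "(Suc n,Ground)"]) (auto simp: creat_S_minus_elem split: if_splits)

lemma S_plus_annih_mult:
  "(S_plus \<cdot> annih \<cdot> B) (m,a) j =
     (if a = Excited then complex_of_real (sqrt (real (Suc m))) * B (Suc m,Ground) j else 0)"
  by (subst op_mult_single[of "(Suc m,Ground)"]) (auto simp: S_plus_annih_elem split: if_splits)

lemma mult_S_plus_annih:
  "(A \<cdot> (S_plus \<cdot> annih)) i (n,b) =
     (if b = Ground then A i (n - 1,Excited) * complex_of_real (sqrt (real n)) else 0)"
  by (subst op_mult_single_right[of "(n - 1,Excited)"]) (cases n; auto simp: S_plus_annih_elem split: if_splits)+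

lemma H_S_mult:
  "(H_S hbar w e \<cdot> B) (m,a) j =
     ((if a = Excited then 1 else -1) * complex_of_real (hbar * w / 2)
        + complex_of_real (hbar * w) * of_nat m) * B (m,a) j
     + (if a = Excited then hbar * e * complex_of_real (sqrt (real (Suc m))) * B (Suc m,Ground) j
        else hbar * cnj e * complex_of_real (sqrt (real m)) * B (m - 1,Excited) j)"
proof (cases a)
  case Excited
  then show ?thesis
    by (subst op_mult_sum[of "{(m,a),(Suc m,Ground)}"]) (auto simp: H_S_elem split: if_splits)
next
  case Ground
  then show ?thesis
    by (subst op_mult_sum[of "{(m,a),(m - 1,Excited)}"]) (cases m; auto simp: H_S_elem split: if_splits)+
qed

lemma mult_H_S:
  "(A \<cdot> H_S hbar w e) i (n,b) =
     A i (n,b) * ((if b = Excited then 1 else -1) * complex_of_real (hbar * w / 2)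
        + complex_of_real (hbar * w) * of_nat n)
     + (if b = Excited then A i (Suc n,Ground) * (hbar * cnj e * complex_of_real (sqrt (real (Suc n))))
        else A i (n - 1,Excited) * (hbar * e * complex_of_real (sqrt (real n))))"
proof (cases b)
  case Excited
  then show ?thesis
    by (subst op_mult_sum[of "{(n,b),(Suc n,Ground)}"]) (auto simp: H_S_elem split: if_splits)
next
  case Ground
  then show ?thesis
    by (subst op_mult_sum[of "{(n,b),(n - 1,Excited)}"]) (cases n; auto simp: H_S_elem split: if_splits)+
qed

lemma generator_elem:
  "generator hbar w e g11 g22 g12 \<rho> i j =
     (- \<i> / complex_of_real hbar) * ((H_S hbar w e \<cdot> \<rho>) i j - (\<rho> \<cdot> H_S hbar w e) i j)
     + complex_of_real g11 * ((S_minus \<cdot> \<rho> \<cdot> S_plus) i j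
         - ((S_plus \<cdot> S_minus \<cdot> \<rho>) i j + (\<rho> \<cdot> (S_plus \<cdot> S_minus)) i j) / 2)
     + complex_of_real g22 * ((annih \<cdot> \<rho> \<cdot> creat) i j
         - ((creat \<cdot> annih \<cdot> \<rho>) i j + (\<rho> \<cdot> (creat \<cdot> annih)) i j) / 2)
     + g12 * ((annih \<cdot> \<rho> \<cdot> S_plus) i j
         - ((creat \<cdot> S_minus \<cdot> \<rho>) i j + (\<rho> \<cdot> (creat \<cdot> S_minus)) i j) / 2)
     + cnj g12 * ((S_minus \<cdot> \<rho> \<cdot> creat) i j
         - ((S_plus \<cdot> annih \<cdot> \<rho>) i j + (\<rho> \<cdot> (S_plus \<cdot> annih)) i j) / 2)"
  by (simp add: generator_def dissipator_def op_scale_def commutator_def anticommutator_def)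

text \<open>After \<open>generator_elem\<close>, these rules peel the known operators off from the
  outside and leave a finite combination of entries of the state.\<close>

lemmas jc_mult_elems =
  S_minus_mult mult_S_plus annih_mult mult_creat S_plus_S_minus_mult mult_S_plus_S_minus
  creat_annih_mult mult_creat_annih creat_S_minus_mult mult_creat_S_minus S_plus_annih_mult
  mult_S_plus_annih H_S_mult mult_H_S

section \<open>Density operators\<close>

lemma density_op_diag:
  assumes "density_op \<rho>"
  shows "\<rho> i i \<in> \<real>\<^sub>\<ge>\<^sub>0"
proof -
  define v :: "'a \<Rightarrow> complex" where "v = (\<lambda>k. 1)"
  have "(\<Sum>k\<in>{i}. \<Sum>l\<in>{i}. cnj (v k) * \<rho> k l * v l) \<in> \<real>\<^sub>\<ge>\<^sub>0"
    using conjunct1[OF assms[unfolded density_op_def], THEN spec, of "{i}"] by simp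
  then show ?thesis by (simp add: v_def)
qed

lemma density_op_pair:
  assumes "density_op \<rho>" "i \<noteq> j"
  shows "cnj x * \<rho> i i * x + cnj x * \<rho> i j * y + cnj y * \<rho> j i * x + cnj y * \<rho> j j * y
           \<in> \<real>\<^sub>\<ge>\<^sub>0"
proof -
  define v where "v = (\<lambda>k. if k = i then x else y)"
  have "(\<Sum>k\<in>{i,j}. \<Sum>l\<in>{i,j}. cnj (v k) * \<rho> k l * v l) \<in> \<real>\<^sub>\<ge>\<^sub>0"
    using conjunct1[OF assms(1)[unfolded density_op_def], THEN spec, of "{i,j}"] by simp
  then show ?thesis using assms(2) by (simp add: v_def add_ac)
qed

text \<open>The quadratic form must be real. The diagonal entries are real, so on the test vectors
  (1, \<i>) and (1, 1) its imaginary part is \<open>Re (\<rho> i j) - Re (\<rho> j i)\<close> and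
  \<open>Im (\<rho> i j) + Im (\<rho> j i)\<close>.\<close>

lemma density_op_hermitian:
  assumes "density_op \<rho>"
  shows "\<rho> j i = cnj (\<rho> i j)"
proof (cases "i = j")
  case True
  then show ?thesis using density_op_diag[OF assms, of i]
    by (simp add: complex_eq_iff complex_nonneg_Reals_iff)
next
  case False
  show ?thesis
  proof (rule complex_eqI)
    have ii: "Im (\<rho> i i) = 0" "Im (\<rho> j j) = 0"
      using density_op_diag[OF assms] by (simp_all add: complex_nonneg_Reals_iff)
    show "Re (\<rho> j i) = Re (cnj (\<rho> i j))"
      using density_op_pair[OF assms False, of 1 \<i>] ii by (simp add: complex_nonneg_Reals_iff)
    show "Im (\<rho> j i) = Im (cnj (\<rho> i j))"
      using density_op_pair[OF assms False, of 1 1] ii by (simp add: complex_nonneg_Reals_iff)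
  qed
qed

lemma density_op_zero_row:
  assumes "density_op \<rho>" "\<rho> i i = 0"
  shows "\<rho> i j = 0"
proof (rule ccontr)
  assume nz: "\<rho> i j \<noteq> 0"
  then have ij: "i \<noteq> j" using assms(2) by auto
  define r where "r = Re (\<rho> j j)"
  define q where "q = (Re (\<rho> i j))\<^sup>2 + (Im (\<rho> i j))\<^sup>2"
  \<comment> \<open>On the test vector with component \<open>- s * \<rho> i j\<close> at
    \<open>i\<close> and 1 at \<open>j\<close> the form equals \<open>r - 2 * s * q\<close>; this
    \<open>s\<close> makes it \<open>- r - 2\<close>, which is negative.\<close>
  define s where "s = (r + 1) / q"
  have q: "q > 0" using nz unfolding q_def by (metis complex_neq_0)
  have r: "r \<ge> 0"
    using density_op_diag[OF assms(1), of j] by (simp add: complex_nonneg_Reals_iff r_def)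
  have h: "\<rho> j i = cnj (\<rho> i j)" by (rule density_op_hermitian[OF assms(1)])
  have "0 \<le> r - 2 * s * q"
    using density_op_pair[OF assms(1) ij, of "- complex_of_real s * \<rho> i j" 1] assms(2)
    by (simp add: complex_nonneg_Reals_iff h r_def q_def power2_eq_square algebra_simps)
  moreover have "s * q = r + 1" using q by (simp add: s_def)
  ultimately show False using r by simp
qed

lemma density_op_partial_trace_le:
  assumes "density_op \<rho>" "finite S"
  shows "(\<Sum>i\<in>S. Re (\<rho> i i)) \<le> 1"
proof -
  have "((\<lambda>i. \<rho> i i) has_sum 1) UNIV"
    using assms(1) by (simp add: density_op_def)
  from has_sum_Re[OF this] have hs: "((\<lambda>i. Re (\<rho> i i)) has_sum 1) UNIV"
    by simp
  have nn: "0 \<le> Re (\<rho> i i)" for i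
    using density_op_diag[OF assms(1), of i] by (auto simp: complex_nonneg_Reals_iff)
  show ?thesis
    by (rule has_sum_mono_neutral[OF has_sum_finite[OF assms(2)] hs]) (use nn in auto)
qed

text \<open>\<open>S\<close> already carries the whole trace, so adjoining \<open>k\<close> leaves
  no room for a positive diagonal entry; a vanishing diagonal entry kills its row by positivity and
  its column by hermiticity.\<close>

lemma density_op_supp:
  assumes "density_op \<rho>" "finite S" "(\<Sum>i\<in>S. Re (\<rho> i i)) = 1" "k \<notin> S"
  shows "\<rho> k j = 0" "\<rho> j k = 0"
proof -
  have "(\<Sum>i\<in>insert k S. Re (\<rho> i i)) \<le> 1"
    using density_op_partial_trace_le[OF assms(1)] assms(2) by blast
  then have "\<rho> k k = 0"
    using assms(2-4) density_op_diag[OF assms(1), of k]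
    by (simp add: complex_eq_iff complex_nonneg_Reals_iff)
  then show row: "\<rho> k j = 0" for j
    by (rule density_op_zero_row[OF assms(1)])
  show "\<rho> j k = 0"
    using density_op_hermitian[OF assms(1), of j k] row[of j] by simp
qed

section \<open>Scalar differential equations on the half line\<close>

lemma nondecreasing_half_line:
  fixes f :: "real \<Rightarrow> real"
  assumes "\<And>t. t \<ge> 0 \<Longrightarrow> (f has_vector_derivative f' t) (at t within {0..})"
    and "\<And>t. t \<ge> 0 \<Longrightarrow> f' t \<ge> 0" and "t \<ge> 0"
  shows "f 0 \<le> f t"
proof (cases "t = 0")
  case False
  have "\<exists>x\<in>{0<..<t}. f t - f 0 = (\<lambda>u. u * f' x) (t - 0)"
  proof (rule mvt_simple)
    show "0 < t" using False assms(3) by simp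
    show "(f has_derivative (\<lambda>u. u * f' x)) (at x within {0..t})" if "0 \<le> x" "x \<le> t" for x
      using has_vector_derivative_within_subset[OF assms(1)[of x], of "{0..t}"] that
      by (auto simp: has_vector_derivative_def)
  qed
  then obtain x where "x \<in> {0<..<t}" "f t - f 0 = t * f' x" by auto
  then show ?thesis using assms(2)[of x] by (smt (verit) greaterThanLessThan_iff mult_nonneg_nonneg)
qed simp

lemma exponential_half_line:
  fixes f :: "real \<Rightarrow> complex"
  assumes "\<And>t. t \<ge> 0 \<Longrightarrow> (f has_vector_derivative c * f t) (at t within {0..})" and "t \<ge> 0"
  shows "f t = exp (c * of_real t) * f 0"
proof -
  \<comment> \<open>Integrating factor: its product with \<open>f\<close> has derivative zero, hence
    is constant on the half line.\<close>
  have "((\<lambda>u. exp (- c * of_real u) * f u) has_vector_derivative 0) (at u within {0..})"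
    if "u \<in> {0..}" for u
  proof -
    have "((\<lambda>u. exp (- c * of_real u)) has_vector_derivative - c * exp (- c * of_real u))
            (at u within {0..})"
      by (rule has_vector_derivative_real_field[of "\<lambda>z. exp (- c * z)"])
         (auto intro!: derivative_eq_intros)
    from has_vector_derivative_mult[OF this assms(1)[of u]] that
    show ?thesis by (simp add: algebra_simps)
  qed
  then obtain d where d: "exp (- c * of_real u) * f u = d" if "u \<in> {0..}" for u
    using has_vector_derivative_zero_constant[of "{0::real..}" "\<lambda>u. exp (- c * of_real u) * f u"]
    by auto
  have "exp (- c * of_real t) * f t = f 0" using d[of 0] d[of t] assms(2) by simp
  moreover have "exp (c * of_real t) * (exp (- c * of_real t) * f t) = f t"
    by (simp flip: exp_add mult.assoc)
  ultimately show ?thesis by simp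
qed

section \<open>The decoherence free regime\<close>

abbreviation (input) G0 :: jc where "G0 \<equiv> (0, Ground)"
abbreviation (input) E0 :: jc where "E0 \<equiv> (0, Excited)"
text \<open>Photon number one is spelled \<open>Suc 0\<close> because the product rules produce
  successors.\<close>

abbreviation (input) G1 :: jc where "G1 \<equiv> (Suc 0, Ground)"

section \<open>Distances on a finite block and entries of the projections\<close>

lemma within_tolerance_finite:
  assumes "finite S" "\<And>i j. i \<notin> S \<or> j \<notin> S \<Longrightarrow> A i j = B i j"
    and "(\<Sum>i\<in>S. \<Sum>j\<in>S. cmod (A i j - B i j)) < \<eta>"
  shows "within_tolerance \<eta> A B"
proof -
  let ?f = "\<lambda>(i, j). cmod (A i j - B i j)"
  have zero: "?f z = 0" if "z \<notin> S \<times> S" for z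
    using that assms(2)[of "fst z" "snd z"] by (cases z) auto
  have "(?f has_sum sum ?f (S \<times> S)) UNIV"
    by (rule has_sum_finite_neutralI[of "S \<times> S"]) (use assms(1) zero in auto)
  moreover have "sum ?f (S \<times> S) < \<eta>"
    using assms(3) by (simp add: sum.cartesian_product)
  ultimately show ?thesis
    unfolding within_tolerance_def by (auto simp: has_sum_imp_summable infsumI)
qed

lemma one_excitation_part_elem:
  "one_excitation_part A i j = (if i \<in> {E0, G1} \<and> j \<in> {E0, G1} then A i j else 0)"
proof -
  let ?P = "proj (ket E0) + proj (ket (1, Ground))"
  have P: "?P k l = of_bool (k = l \<and> k \<in> {E0, G1})" for k l
    by (auto simp: ketbra_def ket_def)
  have "(?P \<cdot> A \<cdot> ?P) i j = (?P \<cdot> A) i j * ?P j j"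
    by (rule op_mult_single_right) (auto simp: ketbra_def ket_def)
  also have "(?P \<cdot> A) i j = ?P i i * A i j"
    by (rule op_mult_single) (auto simp: ketbra_def ket_def)
  finally show ?thesis
    unfolding one_excitation_part_def Let_def P by auto
qed

lemma proj_\<psi>_A_elem:
  "proj \<psi>_A i j =
     (if i \<in> {E0, G1} \<and> j \<in> {E0, G1} then if i = j then 1/2 else - 1/2 else 0)"
proof -
  have [simp]: "complex_of_real (sqrt 2) * complex_of_real (sqrt 2) = 2"
    by (simp flip: of_real_mult)
  show ?thesis
    by (auto simp: ketbra_def \<psi>_A_def ket_def)
qed

lemma sqrt_2_mult_sqrt_2:
  "complex_of_real (sqrt 2) * (complex_of_real (sqrt 2) * z) = 2 * z"
  by (simp add: mult.assoc[symmetric] of_real_mult[symmetric] del: of_real_mult)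

text \<open>With equal rates, a cross rate \<open>sqrt (\<gamma>11 * \<gamma>22)\<close> is again
  the common rate. One \<gamma> then multiplies all four terms, and the dissipator has the single
  jump operator \<open>L = S\<^sub>- + \<alpha>\<close>.\<close>

locale decoherence_free_solution =
  fixes hbar \<omega>\<^sub>0 e \<gamma> :: real and \<rho> :: "real \<Rightarrow> jc op"
  assumes hbar: "hbar > 0" and \<gamma>: "\<gamma> > 0"
    and sol: "master_solution hbar \<omega>\<^sub>0 (complex_of_real e) \<gamma> \<gamma> (complex_of_real \<gamma>) \<rho>"
    and init: "\<rho> 0 = proj (ket E0)"
begin

abbreviation gen :: "jc op \<Rightarrow> jc op" where
  "gen \<equiv> generator hbar \<omega>\<^sub>0 (complex_of_real e) \<gamma> \<gamma> (complex_of_real \<gamma>)"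

section \<open>Confinement to at most one excitation, and the explicit solution\<close>

lemma density: "t \<ge> 0 \<Longrightarrow> density_op (\<rho> t)"
  using sol by (simp add: master_solution_def)

lemma derivative:
  "t \<ge> 0 \<Longrightarrow> ((\<lambda>u. \<rho> u i j) has_vector_derivative gen (\<rho> t) i j) (at t within {0..})"
  using sol unfolding master_solution_def by blast

text \<open>The commutator and the decay among these three levels cancel in the sum; what remains is
  the feeding by \<open>L\<close> from the two-excitation levels |1,+> and |2,->.\<close>

lemma low_population_gain:
  "gen A G0 G0 + gen A E0 E0 + gen A G1 G1 =
     \<gamma> * (2 * A (Suc 0,Excited) (Suc 0,Excited)
          + complex_of_real (sqrt 2) * A (Suc 0,Excited) (Suc (Suc 0),Ground)
          + complex_of_real (sqrt 2) * A (Suc (Suc 0),Ground) (Suc 0,Excited)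
          + 2 * A (Suc (Suc 0),Ground) (Suc (Suc 0),Ground))"
  using hbar by (simp add: generator_elem jc_mult_elems sqrt_2_mult_sqrt_2 field_simps)

text \<open>The derivative of the population is \<open>\<gamma> tr (P\<^sub>1 L \<rho> L\<^sup>\<dagger> P\<^sub>1) \<ge> 0\<close>, \<open>P\<^sub>1\<close> the projection on one
  excitation.\<close>

lemma low_population:
  assumes "t \<ge> 0"
  shows "(\<Sum>i\<in>{G0, E0, G1}. Re (\<rho> t i i)) = 1"
proof -
  define p where "p = (\<lambda>t. \<rho> t G0 G0 + \<rho> t E0 E0 + \<rho> t G1 G1)"
  define p' where "p' = (\<lambda>t. gen (\<rho> t) G0 G0 + gen (\<rho> t) E0 E0 + gen (\<rho> t) G1 G1)"
  have "(p has_vector_derivative p' u) (at u within {0..})" if "u \<ge> 0" for u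
    unfolding p_def p'_def by (intro has_vector_derivative_add derivative that)
  then have der: "((\<lambda>u. Re (p u)) has_vector_derivative Re (p' u)) (at u within {0..})"
    if "u \<ge> 0" for u
    using bounded_linear.has_vector_derivative[OF bounded_linear_Re] that by blast
  have nonneg: "Re (p' u) \<ge> 0" if "u \<ge> 0" for u
  proof -
    let ?i = "(Suc 0, Excited)" and ?j = "(Suc (Suc 0), Ground)" and ?s = "complex_of_real (sqrt 2)"
    \<comment> \<open>The isolated entry belongs to \<open><0,+|L = <1,+|\<close>, the bracket to
      \<open><1,-|L = <1,+| + sqrt 2 <2,-|\<close>; hence the test vector (1, sqrt 2).\<close>
    have "\<rho> u ?i ?i + (\<rho> u ?i ?i + \<rho> u ?i ?j * ?s + ?s * \<rho> u ?j ?i + ?s * \<rho> u ?j ?j * ?s)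
            \<in> \<real>\<^sub>\<ge>\<^sub>0"
      using density_op_pair[OF density[OF that], of ?i ?j 1 ?s]
      by (intro nonneg_Reals_add_I[OF density_op_diag[OF density[OF that]]]) simp
    then have "p' u \<in> \<real>\<^sub>\<ge>\<^sub>0"
      using \<gamma> unfolding p'_def low_population_gain
      by (intro nonneg_Reals_mult_I) (simp_all add: sqrt_2_mult_sqrt_2 algebra_simps)
    then show ?thesis by (simp add: complex_nonneg_Reals_iff)
  qed
  have "Re (p 0) = 1" by (simp add: p_def init ketbra_def ket_def)
  then have "Re (p t) \<ge> 1" using nondecreasing_half_line[OF der nonneg assms] by simp
  then show ?thesis
    using density_op_partial_trace_le[OF density[OF assms], of "{G0, E0, G1}"] by (simp add: p_def)
qed

lemma supp:
  assumes "t \<ge> 0" "k \<notin> {G0, E0, G1}"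
  shows "\<rho> t k j = 0" "\<rho> t j k = 0"
  using density_op_supp[OF density[OF assms(1)] _ low_population[OF assms(1)] assms(2)] by auto

text \<open>A linear functional of the entries that is a left eigenvector of the generator evolves
  as a pure exponential. The eigenvalue equation is asked for along the solution, where
  \<open>supp\<close> is available. Initially only the entry at |0,+> is nonzero, which leaves
  \<open>x1\<close>.\<close>

lemma mode:
  assumes "t \<ge> 0"
    and "\<And>u. u \<ge> 0 \<Longrightarrow>
      x1 * gen (\<rho> u) E0 E0 + x2 * gen (\<rho> u) G1 G1 + x3 * gen (\<rho> u) E0 G1 + x4 * gen (\<rho> u) G1 E0
        + x5 * gen (\<rho> u) G0 E0 + x6 * gen (\<rho> u) G0 G1
      = c * (x1 * \<rho> u E0 E0 + x2 * \<rho> u G1 G1 + x3 * \<rho> u E0 G1 + x4 * \<rho> u G1 E0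
        + x5 * \<rho> u G0 E0 + x6 * \<rho> u G0 G1)"
  shows "x1 * \<rho> t E0 E0 + x2 * \<rho> t G1 G1 + x3 * \<rho> t E0 G1 + x4 * \<rho> t G1 E0
    + x5 * \<rho> t G0 E0 + x6 * \<rho> t G0 G1 = exp (c * of_real t) * x1"
proof -
  let ?f = "\<lambda>u. x1 * \<rho> u E0 E0 + x2 * \<rho> u G1 G1 + x3 * \<rho> u E0 G1 + x4 * \<rho> u G1 E0
    + x5 * \<rho> u G0 E0 + x6 * \<rho> u G0 G1"
  have "(?f has_vector_derivative c * ?f u) (at u within {0..})" if "u \<ge> 0" for u
    unfolding assms(2)[OF that, symmetric]
    by (intro has_vector_derivative_add has_vector_derivative_mult_right derivative that)
  from exponential_half_line[of ?f, OF this assms(1)] show ?thesis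
    by (simp add: init ketbra_def ket_def)
qed

text \<open>By \<open>supp\<close> nothing is fed in from higher levels, so these two coherences
  satisfy a closed linear system, as do the four entries in
  \<open>gen_one_excitation\<close>.\<close>

lemma gen_G0:
  assumes "u \<ge> 0"
  shows "gen (\<rho> u) G0 E0 = \<i> * (\<omega>\<^sub>0 * \<rho> u G0 E0 + e * \<rho> u G0 G1) - \<gamma> / 2 * (\<rho> u G0 E0 + \<rho> u G0 G1)"
    and "gen (\<rho> u) G0 G1 = \<i> * (\<omega>\<^sub>0 * \<rho> u G0 G1 + e * \<rho> u G0 E0) - \<gamma> / 2 * (\<rho> u G0 E0 + \<rho> u G0 G1)"
  using hbar assms by (simp_all add: generator_elem jc_mult_elems supp field_simps)

text \<open>Atom and mode are resonant: |0,+> and |1,-> have the same free energy, so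
  \<open>\<omega>\<^sub>0\<close> cancels.\<close>

lemma gen_one_excitation:
  assumes "u \<ge> 0"
  shows "gen (\<rho> u) E0 E0 = - \<i> * e * (\<rho> u G1 E0 - \<rho> u E0 G1) - \<gamma> / 2 * (2 * \<rho> u E0 E0 + \<rho> u G1 E0 + \<rho> u E0 G1)"
    and "gen (\<rho> u) G1 G1 = - \<i> * e * (\<rho> u E0 G1 - \<rho> u G1 E0) - \<gamma> / 2 * (2 * \<rho> u G1 G1 + \<rho> u G1 E0 + \<rho> u E0 G1)"
    and "gen (\<rho> u) E0 G1 = - \<i> * e * (\<rho> u G1 G1 - \<rho> u E0 E0) - \<gamma> / 2 * (2 * \<rho> u E0 G1 + \<rho> u G1 G1 + \<rho> u E0 E0)"
    and "gen (\<rho> u) G1 E0 = - \<i> * e * (\<rho> u E0 E0 - \<rho> u G1 G1) - \<gamma> / 2 * (2 * \<rho> u G1 E0 + \<rho> u E0 E0 + \<rho> u G1 G1)"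
  using hbar assms by (simp_all add: generator_elem jc_mult_elems supp field_simps)

text \<open>The modes are the matrix elements between the symmetric and antisymmetric states
  \<open>(|0,+\<rangle> \<plusminus> |1,-\<rangle>)/\<surd>2\<close>.\<close>

lemma solution:
  assumes "t \<ge> 0"
  shows "\<rho> t E0 E0 + \<rho> t G1 G1 - \<rho> t E0 G1 - \<rho> t G1 E0 = 1"
    and "\<rho> t E0 E0 + \<rho> t G1 G1 + \<rho> t E0 G1 + \<rho> t G1 E0 = exp (- 2 * \<gamma> * t)"
    and "\<rho> t E0 E0 - \<rho> t G1 G1 - \<rho> t E0 G1 + \<rho> t G1 E0 = exp ((- 2 * \<i> * e - \<gamma>) * t)"
    and "\<rho> t E0 E0 - \<rho> t G1 G1 + \<rho> t E0 G1 - \<rho> t G1 E0 = exp ((2 * \<i> * e - \<gamma>) * t)"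
    and "\<rho> t G0 E0 + \<rho> t G0 G1 = 0"
    and "\<rho> t G0 E0 - \<rho> t G0 G1 = 0"
proof -
  note simps = gen_one_excitation gen_G0 field_simps
  show "\<rho> t E0 E0 + \<rho> t G1 G1 - \<rho> t E0 G1 - \<rho> t G1 E0 = 1"
    using mode[OF assms, of 1 1 "-1" "-1" 0 0 0] by (simp add: simps)
  show "\<rho> t E0 E0 + \<rho> t G1 G1 + \<rho> t E0 G1 + \<rho> t G1 E0 = exp (- 2 * \<gamma> * t)"
    using mode[OF assms, of 1 1 1 1 0 0 "- 2 * \<gamma>"] by (simp add: simps exp_of_real[symmetric])
  show "\<rho> t E0 E0 - \<rho> t G1 G1 - \<rho> t E0 G1 + \<rho> t G1 E0 = exp ((- 2 * \<i> * e - \<gamma>) * t)"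
    using mode[OF assms, of 1 "-1" "-1" 1 0 0 "- 2 * \<i> * e - \<gamma>"] by (simp add: simps)
  show "\<rho> t E0 E0 - \<rho> t G1 G1 + \<rho> t E0 G1 - \<rho> t G1 E0 = exp ((2 * \<i> * e - \<gamma>) * t)"
    using mode[OF assms, of 1 "-1" 1 "-1" 0 0 "2 * \<i> * e - \<gamma>"] by (simp add: simps)
  \<comment> \<open>The coherences of the ground state with the symmetric and the antisymmetric
    state. The latter has an imaginary eigenvalue and does not decay; it vanishes because it does so
    initially.\<close>
  show "\<rho> t G0 E0 + \<rho> t G0 G1 = 0"
    using mode[OF assms, of 0 0 0 0 1 1 "\<i> * (\<omega>\<^sub>0 + e) - \<gamma>"] by (simp add: simps)
  show "\<rho> t G0 E0 - \<rho> t G0 G1 = 0"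
    using mode[OF assms, of 0 0 0 0 1 "-1" "\<i> * (\<omega>\<^sub>0 - e)"] by (simp add: simps)
qed

text \<open>Inverts the four sign combinations of \<open>solution\<close>. The oscillating
  coherences are hidden in \<open>d\<close> and \<open>d'\<close>, as the later estimates use their
  modulus only.\<close>

lemma one_excitation_elems:
  assumes "t \<ge> 0"
  defines "x \<equiv> exp (- \<gamma> * t)"
  obtains d d' where "cmod d = x" "cmod d' = x"
    "\<rho> t E0 E0 = (1 + of_real (x\<^sup>2) + d + d') / 4" "\<rho> t G1 G1 = (1 + of_real (x\<^sup>2) - d - d') / 4"
    "\<rho> t E0 G1 = (of_real (x\<^sup>2) - 1 - d + d') / 4" "\<rho> t G1 E0 = (of_real (x\<^sup>2) - 1 + d - d') / 4"
proof -
  define d d' where "d = exp ((- 2 * \<i> * e - \<gamma>) * t)" and "d' = exp ((2 * \<i> * e - \<gamma>) * t)"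
  have x2: "exp (- 2 * \<gamma> * t) = x\<^sup>2" by (simp add: x_def flip: exp_double)
  note sol = solution(1-4)[OF assms(1), folded d_def d'_def, unfolded x2]
  show thesis
  proof (rule that[of d d'])
    show "cmod d = x" "cmod d' = x" by (simp_all add: d_def d'_def x_def norm_exp)
    have *: "a = (s + u + v + w) / 4" "b = (s + u - v - w) / 4" "c = (u - s - v + w) / 4"
      "c' = (u - s + v - w) / 4"
      if "a + b - c - c' = s" "a + b + c + c' = u" "a - b - c + c' = v" "a - b + c - c' = w"
      for a b c c' s u v w :: complex
      unfolding that[symmetric] by (simp_all add: field_simps)
    show "\<rho> t E0 E0 = (1 + of_real (x\<^sup>2) + d + d') / 4" "\<rho> t G1 G1 = (1 + of_real (x\<^sup>2) - d - d') / 4"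
      "\<rho> t E0 G1 = (of_real (x\<^sup>2) - 1 - d + d') / 4" "\<rho> t G1 E0 = (of_real (x\<^sup>2) - 1 + d - d') / 4"
      using *[OF sol] by blast+
  qed
qed

text \<open>The coherences drop out. Half of the initial excitation sits in \<open>\<psi>_A\<close>
  and is conserved; the other half is symmetric and decays.\<close>

lemma excited_population:
  assumes "t \<ge> 0"
  shows "\<rho> t E0 E0 + \<rho> t G1 G1 = of_real ((1 + (exp (- \<gamma> * t))\<^sup>2) / 2)"
proof -
  obtain d d' where
    "\<rho> t E0 E0 = (1 + of_real ((exp (- \<gamma> * t))\<^sup>2) + d + d') / 4"
    "\<rho> t G1 G1 = (1 + of_real ((exp (- \<gamma> * t))\<^sup>2) - d - d') / 4"
    using one_excitation_elems[OF assms] by blast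
  then have "\<rho> t E0 E0 + \<rho> t G1 G1 = (1 + of_real ((exp (- \<gamma> * t))\<^sup>2)) / 2"
    by (simp only: flip: add_divide_distrib) simp
  then show ?thesis by simp
qed

text \<open>Read off from the total population 1 of the three levels, without a differential
  equation of its own.\<close>

lemma ground_population:
  assumes "t \<ge> 0"
  shows "\<rho> t G0 G0 = of_real ((1 - (exp (- \<gamma> * t))\<^sup>2) / 2)"
proof -
  have "Im (\<rho> t G0 G0) = 0"
    using density_op_diag[OF density[OF assms], of G0] by (simp add: complex_nonneg_Reals_iff)
  moreover have "Re (\<rho> t E0 E0) + Re (\<rho> t G1 G1) = (1 + (exp (- \<gamma> * t))\<^sup>2) / 2"
    using arg_cong[OF excited_population[OF assms], of Re] by simp
  ultimately show ?thesis
    using low_population[OF assms] by (simp add: complex_eq_iff field_simps)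
qed

lemma off_block:
  assumes "t \<ge> 0"
  shows "\<rho> t G0 E0 = 0" "\<rho> t G0 G1 = 0" "\<rho> t E0 G0 = 0" "\<rho> t G1 G0 = 0"
proof -
  show *: "\<rho> t G0 E0 = 0" "\<rho> t G0 G1 = 0"
    using solution(5,6)[OF assms] by (simp_all add: eq_neg_iff_add_eq_0)
  show "\<rho> t E0 G0 = 0" "\<rho> t G1 G0 = 0"
    using * density_op_hermitian[OF density[OF assms], of E0 G0]
      density_op_hermitian[OF density[OF assms], of G1 G0] by simp_all
qed

section \<open>Energy probability and distances to the limit states\<close>

lemma prob_energy_eq:
  assumes "t \<ge> 0"
  shows "prob_energy (\<rho> t) = (1 + (exp (- \<gamma> * t))\<^sup>2) / 2"
proof -
  have zero: "\<rho> t k k = 0" if "excitations k > 0" "k \<notin> {E0, G1}" for k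
  proof (rule supp(1)[OF assms])
    show "k \<notin> {G0, E0, G1}" using that by auto
  qed
  have "prob_energy (\<rho> t) = (\<Sum>\<^sub>\<infinity>k\<in>{E0, G1}. Re (\<rho> t k k))"
    unfolding prob_energy_def by (rule infsum_cong_neutral) (use zero in auto)
  also have "\<dots> = (1 + (exp (- \<gamma> * t))\<^sup>2) / 2"
    using arg_cong[OF excited_population[OF assms], of Re] by simp
  finally show ?thesis .
qed

text \<open>Error budget with \<open>x = exp (- \<gamma> * t)\<close>, where
  \<open>x\<^sup>2 \<le> x\<close>: the ground entry is off by at most x/2 and each of the four
  one-excitation entries by at most 3x/4, together less than 4x.\<close>

lemma asymptotic_distance:
  assumes "t \<ge> 0" "4 * exp (- \<gamma> * t) < \<eta>"
  shows "within_tolerance \<eta> (\<rho> t) asymptotic_state"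
proof (rule within_tolerance_finite[of "{G0, E0, G1}"])
  define x where "x = exp (- \<gamma> * t)"
  define f where "f = (\<lambda>i j. cmod (\<rho> t i j - asymptotic_state i j))"
  have x: "0 < x" "x \<le> 1" using assms(1) \<gamma> by (auto simp: x_def)
  have x2: "x\<^sup>2 \<le> x" using x by (simp add: power2_eq_square mult_left_le_one_le)
  show "\<rho> t i j = asymptotic_state i j" if "i \<notin> {G0, E0, G1} \<or> j \<notin> {G0, E0, G1}" for i j
  proof -
    have "\<rho> t i j = 0" using that supp[OF assms(1)] by blast
    moreover have "asymptotic_state i j = 0" using that by (auto simp: asymptotic_state_elem)
    ultimately show ?thesis by simp
  qed
  obtain d d' where d: "cmod d = x" "cmod d' = x"
    and elems: "\<rho> t E0 E0 = (1 + of_real (x\<^sup>2) + d + d') / 4" "\<rho> t G1 G1 = (1 + of_real (x\<^sup>2) - d - d') / 4"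
      "\<rho> t E0 G1 = (of_real (x\<^sup>2) - 1 - d + d') / 4" "\<rho> t G1 E0 = (of_real (x\<^sup>2) - 1 + d - d') / 4"
    by (rule one_excitation_elems[OF assms(1), folded x_def])
  have bound: "cmod ((of_real (x\<^sup>2) + b + c) / 4) \<le> 3 / 4 * x" if "cmod b = x" "cmod c = x" for b c
    using norm_triangle_ineq[of "of_real (x\<^sup>2) + b" c] norm_triangle_ineq[of "of_real (x\<^sup>2)" b] that x2
    by (simp add: norm_divide norm_power)
  have "\<rho> t G0 G0 - asymptotic_state G0 G0 = - of_real (x\<^sup>2) / 2"
    using ground_population[OF assms(1), folded x_def]
    by (simp add: asymptotic_state_elem diff_divide_distrib)
  then have "f G0 G0 = x\<^sup>2 / 2"
    by (simp add: f_def norm_divide norm_power)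
  moreover have eqs: "\<rho> t E0 E0 - asymptotic_state E0 E0 = (of_real (x\<^sup>2) + d + d') / 4"
    "\<rho> t G1 G1 - asymptotic_state G1 G1 = (of_real (x\<^sup>2) + - d + - d') / 4"
    "\<rho> t E0 G1 - asymptotic_state E0 G1 = (of_real (x\<^sup>2) + - d + d') / 4"
    "\<rho> t G1 E0 - asymptotic_state G1 E0 = (of_real (x\<^sup>2) + d + - d') / 4"
    by (simp_all add: elems asymptotic_state_elem add_divide_distrib diff_divide_distrib)
  moreover have "f E0 E0 \<le> 3 / 4 * x" "f G1 G1 \<le> 3 / 4 * x" "f E0 G1 \<le> 3 / 4 * x" "f G1 E0 \<le> 3 / 4 * x"
    unfolding f_def eqs by (rule bound; simp add: d)+
  moreover have "f G0 E0 = 0" "f G0 G1 = 0" "f E0 G0 = 0" "f G1 G0 = 0"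
    using off_block[OF assms(1)] by (auto simp: asymptotic_state_elem f_def)
  ultimately have "(\<Sum>i\<in>{G0, E0, G1}. \<Sum>j\<in>{G0, E0, G1}. f i j) < \<eta>"
    using x2 x assms(2)[folded x_def] by simp
  then show "(\<Sum>i\<in>{G0, E0, G1}. \<Sum>j\<in>{G0, E0, G1}. cmod (\<rho> t i j - asymptotic_state i j)) < \<eta>"
    by (simp only: f_def)
qed simp

text \<open>Normalization by \<open>p\<close> makes the weight 1/2 of \<open>\<psi>_A\<close> into
  nearly 1. Each diagonal entry is then off by at most x and each off-diagonal one by at most 2x,
  which gives the constant 6.\<close>

lemma conditional_distance:
  assumes "t \<ge> 0" "6 * exp (- \<gamma> * t) < \<eta>"
    and p: "p = Re (\<rho> t E0 E0 + \<rho> t G1 G1)"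
  shows "within_tolerance \<eta> (complex_of_real (1 / p) *\<^sub>C one_excitation_part (\<rho> t)) (proj \<psi>_A)"
proof (rule within_tolerance_finite[of "{E0, G1}"])
  define x where "x = exp (- \<gamma> * t)"
  define q where "q = complex_of_real (1 + x\<^sup>2)"
  define \<sigma> where "\<sigma> = complex_of_real (1 / p) *\<^sub>C one_excitation_part (\<rho> t)"
  define f where "f = (\<lambda>i j. cmod (\<sigma> i j - proj \<psi>_A i j))"
  show "\<sigma> i j = proj \<psi>_A i j" if "i \<notin> {E0, G1} \<or> j \<notin> {E0, G1}" for i j
    using that by (auto simp: \<sigma>_def op_scale_def one_excitation_part_elem proj_\<psi>_A_elem)
  have x: "0 < x" "x \<le> 1" using assms(1) \<gamma> by (auto simp: x_def)
  have x2: "x\<^sup>2 \<le> x" using x by (simp add: power2_eq_square mult_left_le_one_le)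
  have "1 + x\<^sup>2 > 0" by (simp add: add_pos_nonneg)
  then have q: "q \<noteq> 0" by (simp only: q_def of_real_eq_0_iff)
  obtain d d' where d: "cmod d = x" "cmod d' = x"
    and elems: "\<rho> t E0 E0 = (1 + of_real (x\<^sup>2) + d + d') / 4" "\<rho> t G1 G1 = (1 + of_real (x\<^sup>2) - d - d') / 4"
      "\<rho> t E0 G1 = (of_real (x\<^sup>2) - 1 - d + d') / 4" "\<rho> t G1 E0 = (of_real (x\<^sup>2) - 1 + d - d') / 4"
    by (rule one_excitation_elems[OF assms(1), folded x_def])
  \<comment> \<open>Writing \<open>x\<^sup>2 - 1\<close> as \<open>2 * x\<^sup>2 - q\<close> makes
    division by \<open>q\<close> yield the exact value -1/2 of \<open>proj \<psi>_A\<close> plus a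
    small remainder.\<close>
  have elems': "\<rho> t E0 E0 = (q + d + d') / 4" "\<rho> t G1 G1 = (q - d - d') / 4"
      "\<rho> t E0 G1 = (of_real (2 * x\<^sup>2) - q - d + d') / 4" "\<rho> t G1 E0 = (of_real (2 * x\<^sup>2) - q + d - d') / 4"
    by (simp_all add: elems q_def)
  have "complex_of_real (1 / p) = 2 / q"
    unfolding p excited_population[OF assms(1), folded x_def] q_def by simp
  then have \<sigma>: "\<sigma> i j = 2 * \<rho> t i j / q" if "i \<in> {E0, G1}" "j \<in> {E0, G1}" for i j
    using that by (simp add: \<sigma>_def op_scale_def one_excitation_part_elem)
  \<comment> \<open>As \<open>q\<close> is at least 1, normalization does not enlarge the
    errors.\<close>
  have norm_q: "cmod (z / (2 * q)) \<le> cmod z / 2" for z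
  proof -
    have "cmod q = 1 + x\<^sup>2" unfolding q_def norm_of_real by simp
    then have "cmod (z / (2 * q)) = (cmod z / 2) / (1 + x\<^sup>2)" by (simp add: norm_divide norm_mult)
    also have "\<dots> \<le> (cmod z / 2) / 1" by (intro divide_left_mono) (simp_all add: add_pos_nonneg)
    finally show ?thesis by simp
  qed
  have bound: "cmod ((of_real (2 * x\<^sup>2) + b + c) / (2 * q)) \<le> 2 * x" if "cmod b = x" "cmod c = x" for b c
  proof -
    have "cmod (of_real (2 * x\<^sup>2)) = 2 * x\<^sup>2" unfolding norm_of_real by simp
    then show ?thesis
      using norm_triangle_ineq[of "of_real (2 * x\<^sup>2) + b" c] norm_triangle_ineq[of "of_real (2 * x\<^sup>2)" b]
        norm_q[of "of_real (2 * x\<^sup>2) + b + c"] that x2 by linarith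
  qed
  have bound': "cmod ((b + c) / (2 * q)) \<le> x" if "cmod b = x" "cmod c = x" for b c
    using norm_triangle_ineq[of b c] norm_q[of "b + c"] that by linarith
  have eqs: "\<sigma> E0 E0 - proj \<psi>_A E0 E0 = (d + d') / (2 * q)"
    "\<sigma> G1 G1 - proj \<psi>_A G1 G1 = (- d + - d') / (2 * q)"
    "\<sigma> E0 G1 - proj \<psi>_A E0 G1 = (of_real (2 * x\<^sup>2) + - d + d') / (2 * q)"
    "\<sigma> G1 E0 - proj \<psi>_A G1 E0 = (of_real (2 * x\<^sup>2) + d + - d') / (2 * q)"
    using q by (simp_all add: \<sigma> elems' proj_\<psi>_A_elem field_simps)
  have "f E0 E0 \<le> x" "f G1 G1 \<le> x"
    unfolding f_def eqs by (rule bound'; simp add: d)+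
  moreover have "f E0 G1 \<le> 2 * x" "f G1 E0 \<le> 2 * x"
    unfolding f_def eqs by (rule bound; simp add: d)+
  ultimately have "(\<Sum>i\<in>{E0, G1}. \<Sum>j\<in>{E0, G1}. f i j) < \<eta>"
    using assms(2)[folded x_def] by simp
  then show "(\<Sum>i\<in>{E0, G1}. \<Sum>j\<in>{E0, G1}. cmod (\<sigma> i j - proj \<psi>_A i j)) < \<eta>"
    by (simp only: f_def)
qed simp

end

section \<open>The conditional state after no detection\<close>

text \<open>The tensor factor only re-indexes the error matrix along the injection \<open>h\<close>
  and pads it with zeros, so the sum of moduli is unchanged.\<close>

lemma within_tolerance_tensor_proj:
  assumes "within_tolerance \<eta> A B"
  shows "within_tolerance \<eta> (tensor A (proj (ket v))) (tensor B (proj (ket v)))"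
proof -
  define f where "f = (\<lambda>(i, j). cmod (A i j - B i j))"
  define g where "g = (\<lambda>(x, y). cmod (tensor A (proj (ket v)) x y - tensor B (proj (ket v)) x y))"
  define h where "h = (\<lambda>(i::'a, j::'a). ((i, v), (j, v)))"
  have gh: "g \<circ> h = f"
    by (auto simp: f_def g_def h_def tensor_def ketbra_def ket_def)
  have "(f has_sum infsum f UNIV) UNIV"
    using assms unfolding within_tolerance_def f_def by (intro has_sum_infsum) simp
  moreover have "inj h" by (auto simp: inj_def h_def)
  ultimately have "(g has_sum infsum f UNIV) (range h)"
    using has_sum_reindex[of h UNIV g] by (simp add: gh)
  moreover have "g z = 0" if "z \<notin> range h" for z
  proof -
    obtain i r j s where z: "z = ((i, r), (j, s))" by (metis prod.exhaust)
    have "\<not> (r = v \<and> s = v)"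
    proof
      assume "r = v \<and> s = v"
      then have "z = h (i, j)" by (simp add: h_def z)
      then show False using that by blast
    qed
    then show ?thesis by (auto simp: z g_def tensor_def ketbra_def ket_def)
  qed
  ultimately have "(g has_sum infsum f UNIV) UNIV"
    using has_sum_cong_neutral[of UNIV "range h" g g] by blast
  then show ?thesis
    using assms unfolding within_tolerance_def f_def[symmetric] g_def[symmetric]
    by (auto simp: has_sum_imp_summable infsumI)
qed

lemma ptrace_snd_tensor_proj: "ptrace_snd (tensor A (proj (ket v))) = A"
proof (intro ext)
  fix i j
  have "ptrace_snd (tensor A (proj (ket v))) i j =
      (\<Sum>\<^sub>\<infinity>r\<in>{v}. tensor A (proj (ket v)) (i, r) (j, r))"
    unfolding ptrace_snd_def
    by (rule infsum_cong_neutral) (auto simp: tensor_def ketbra_def ket_def)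
  then show "ptrace_snd (tensor A (proj (ket v))) i j = A i j"
    by (simp add: tensor_def ketbra_def ket_def)
qed

text \<open>No convergence of the trace is assumed: a constant factor passes through
  \<open>infsum\<close> even for divergent families, whose value is 0 by default.\<close>

lemma ptrace_fst_tensor: "ptrace_fst (tensor A B) = op_trace A *\<^sub>C B"
  unfolding ptrace_fst_def op_trace_def op_scale_def tensor_def
  by (simp add: infsum_cmult_left')

lemma op_scale_tensor: "c *\<^sub>C tensor A B = tensor (c *\<^sub>C A) B"
  by (auto simp: op_scale_def tensor_def fun_eq_iff)

section \<open>The vacuum block of a state with one captured excitation\<close>

lemma no_photon_part_elem:
  "no_photon_part X (i, r) (j, s) = (if r = {#} \<and> s = {#} then X (i, r) (j, s) else 0)"
proof -
  have P: "no_photon (k, q) (l, q') = of_bool (k = l \<and> q = {#} \<and> q' = {#})" for k l and q q' :: "'b multiset"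
    by (auto simp: no_photon_def tensor_def op_id_def ketbra_def ket_def)
  have "(no_photon \<cdot> X \<cdot> no_photon) (i, r) (j, s) = (no_photon \<cdot> X) (i, r) (j, s) * no_photon (j, s) (j, s)"
    by (rule op_mult_single_right) (auto simp: P)
  also have "(no_photon \<cdot> X) (i, r) (j, s) = no_photon (i, r) (i, r) * X (i, r) (j, s)"
    by (rule op_mult_single) (auto simp: P)
  finally show ?thesis
    unfolding no_photon_part_def P by auto
qed

lemma excitations_eq_1: "excitations i = 1 \<longleftrightarrow> i \<in> {E0, G1}"
  by (cases i; cases "snd i") auto

text \<open>Each excitation is either in the system or a photon, so on the one-excitation sector the
  partial trace over the reservoir only sees the vacuum.\<close>

lemma no_photon_part_captured:
  assumes "captures_lost_excitations X"
  shows "no_photon_part X = tensor (one_excitation_part (ptrace_snd X)) (proj (ket {#}))"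
proof -
  have X: "excitations i + size r = 1 \<and> excitations j + size s = 1" if "X (i, r) (j, s) \<noteq> 0" for i r j s
    using assms that unfolding captures_lost_excitations_def by blast
  have vac: "X (i, {#}) (j, {#}) = one_excitation_part (ptrace_snd X) i j" for i j
  proof (cases "i \<in> {E0, G1} \<and> j \<in> {E0, G1}")
    case True
    have "X (i, r) (j, r) = 0" if "r \<noteq> {#}" for r
      using X[of i r j r] True that by (fastforce simp flip: excitations_eq_1)
    then have "ptrace_snd X i j = (\<Sum>\<^sub>\<infinity>r\<in>{{#}}. X (i, r) (j, r))"
      unfolding ptrace_snd_def by (intro infsum_cong_neutral) auto
    then show ?thesis using True by (simp add: one_excitation_part_elem)
  next
    case False
    then have "\<not> (excitations i = 1 \<and> excitations j = 1)"
      using excitations_eq_1 by blast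
    then have "X (i, {#}) (j, {#}) = 0"
      using X[of i "{#}" j "{#}"] by auto
    then show ?thesis using False by (auto simp: one_excitation_part_elem)
  qed
  show ?thesis
    by (intro ext) (auto simp: no_photon_part_elem vac tensor_def ketbra_def ket_def)
qed

lemma op_trace_one_excitation_part: "op_trace (one_excitation_part A) = A E0 E0 + A G1 G1"
proof -
  have "op_trace (one_excitation_part A) = (\<Sum>\<^sub>\<infinity>i\<in>{E0, G1}. one_excitation_part A i i)"
    unfolding op_trace_def by (rule infsum_cong_neutral) (auto simp: one_excitation_part_elem)
  then show ?thesis by (simp add: one_excitation_part_elem)
qed

lemma no_photon_prob_captured:
  fixes X :: "(jc \<times> 'k multiset) op"
  assumes "captures_lost_excitations X"
  shows "no_photon_prob X = Re (ptrace_snd X E0 E0 + ptrace_snd X G1 G1)"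
proof -
  let ?A = "one_excitation_part (ptrace_snd X)"
  have "op_trace (no_photon_part X) =
      (\<Sum>\<^sub>\<infinity>z\<in>{(E0, {#}), (G1, {#})}. tensor ?A (proj (ket ({#} :: 'k multiset))) z z)"
    unfolding op_trace_def no_photon_part_captured[OF assms]
    by (rule infsum_cong_neutral)
      (auto simp: tensor_def one_excitation_part_elem ketbra_def ket_def split: if_splits)
  then show ?thesis
    by (simp add: no_photon_prob_def tensor_def one_excitation_part_elem ketbra_def ket_def)
qed

text \<open>Each photon number in \<open>\<psi>_A\<close> occurs with a single atomic level, so
  tracing out the mode leaves no coherence, just the two weights 1/2.\<close>

lemma maximally_entangled_\<psi>_A: "maximally_entangled \<psi>_A"
  unfolding maximally_entangled_def
proof (intro ext)
  fix r s
  have "ptrace_fst (proj \<psi>_A) r s = (\<Sum>\<^sub>\<infinity>m\<in>{0, Suc 0}. proj \<psi>_A (m, r) (m, s))"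
    unfolding ptrace_fst_def by (rule infsum_cong_neutral) (auto simp: proj_\<psi>_A_elem)
  then show "ptrace_fst (proj \<psi>_A) r s = ((1/2) *\<^sub>C op_id) r s"
    by (cases r; cases s) (auto simp: proj_\<psi>_A_elem op_scale_def op_id_def)
qed

text \<open>\<open>exchange\<close> swaps |0,+> with |1,-> and fixes |0,-> and |1,+>, where
  \<open>\<psi>_A\<close> vanishes.\<close>

lemma antisymmetric_\<psi>_A: "antisymmetric \<psi>_A"
  unfolding antisymmetric_def
proof (intro conjI allI impI)
  show "\<psi>_A (m, s) = 0" if "m > 1" for m s
    using that by (auto simp: \<psi>_A_def ket_def)
  show "\<psi>_A (exchange (m, s)) = - \<psi>_A (m, s)" if "m \<le> 1" for m s
    using that by (cases s; cases m) (auto simp: \<psi>_A_def ket_def)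
qed

text \<open>"Much later than the decay time" becomes a bound \<open>K\<close> that depends on the
  tolerance alone, uniformly in all physical parameters. The conditions on \<open>\<gamma>12\<close>
  and \<epsilon> are, for equal rates, exactly those of
  \<open>asymptotic_state_stationary_iff\<close>.\<close>

theorem mainTheorem2:
  fixes \<eta> :: real
  assumes "\<eta> > 0"
  shows "\<exists>K>0. \<forall>(hbar::real) (\<omega>\<^sub>0::real) (\<epsilon>::complex)
           (R::'m measure) (g::'m \<Rightarrow> complex) (s::'m \<Rightarrow> complex)
           (\<gamma>11::real) (\<gamma>22::real) (\<gamma>12::complex) (\<rho>::real \<Rightarrow> jc op) (t::real).
      hbar > 0 \<longrightarrow> \<omega>\<^sub>0 > 0 \<longrightarrow>
      g \<in> borel_measurable R \<longrightarrow> integrable R (\<lambda>\<kappa>. (cmod (g \<kappa>))\<^sup>2) \<longrightarrow>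
      s \<in> borel_measurable R \<longrightarrow> integrable R (\<lambda>\<kappa>. (cmod (s \<kappa>))\<^sup>2) \<longrightarrow>
      \<gamma>11 = decay_rate R g \<longrightarrow> \<gamma>22 = decay_rate R s \<longrightarrow> \<gamma>12 = cross_rate hbar R g s \<longrightarrow>
      \<gamma>11 + \<gamma>22 > 0 \<longrightarrow>
      \<gamma>12 = complex_of_real (sqrt (\<gamma>11 * \<gamma>22)) \<longrightarrow> \<epsilon> \<in> \<real> \<longrightarrow>
      \<gamma>11 = \<gamma>22 \<longrightarrow>
      master_solution hbar \<omega>\<^sub>0 \<epsilon> \<gamma>11 \<gamma>22 \<gamma>12 \<rho> \<longrightarrow>
      \<rho> 0 = proj (ket (0, Excited)) \<longrightarrow>
      t \<ge> K / (\<gamma>11 + \<gamma>22) \<longrightarrow>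
        within_tolerance \<eta> (\<rho> t) ((1/2) *\<^sub>C proj \<psi>_G + (1/2) *\<^sub>C proj \<psi>_A) \<and>
        \<bar>prob_energy (\<rho> t) - 1/2\<bar> < \<eta> \<and>
        (\<forall>X::(jc \<times> 'k multiset) op.
           density_op X \<longrightarrow> ptrace_snd X = \<rho> t \<longrightarrow> captures_lost_excitations X \<longrightarrow>
             no_photon_prob X > 0 \<and>
             ptrace_snd (no_photon_part X) = one_excitation_part (\<rho> t) \<and>
             within_tolerance \<eta> (no_photon_state X) (tensor (proj \<psi>_A) (proj (ket {#}))) \<and>
             within_tolerance \<eta> (ptrace_snd (no_photon_state X)) (proj \<psi>_A) \<and>
             uncorrelated (no_photon_state X)) \<and>
        maximally_entangled \<psi>_A \<and> antisymmetric \<psi>_A"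
proof (intro exI[of _ "16 / \<eta>"] conjI[of "16 / \<eta> > 0"] allI impI)
  \<comment> \<open>Since the rates add up to 2\<gamma>, this \<open>K\<close> gives
    \<open>\<gamma> * t \<ge> 8 / \<eta>\<close>; then \<open>exp y \<ge> 1 + y\<close> gives
    \<open>8 * x < \<eta>\<close> for \<open>x = exp (- \<gamma> * t)\<close>, enough for the
    constants 4 and 6 of the distance lemmas.\<close>
  show "16 / \<eta> > 0" using assms by simp
  fix hbar \<omega>\<^sub>0 :: real and \<epsilon> :: complex and R :: "'m measure" and g s :: "'m \<Rightarrow> complex"
    and \<gamma>11 \<gamma>22 :: real and \<gamma>12 :: complex and \<rho> :: "real \<Rightarrow> jc op" and t :: real
  assume hbar: "hbar > 0" and pos: "\<gamma>11 + \<gamma>22 > 0"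
    and \<gamma>12: "\<gamma>12 = complex_of_real (sqrt (\<gamma>11 * \<gamma>22))" and \<epsilon>: "\<epsilon> \<in> \<real>" and eq: "\<gamma>11 = \<gamma>22"
    and sol: "master_solution hbar \<omega>\<^sub>0 \<epsilon> \<gamma>11 \<gamma>22 \<gamma>12 \<rho>"
    and init: "\<rho> 0 = proj (ket (0, Excited))"
    and t: "t \<ge> 16 / \<eta> / (\<gamma>11 + \<gamma>22)"
  define \<gamma> where "\<gamma> = \<gamma>22"
  have rates: "\<gamma> > 0" "\<gamma>11 = \<gamma>" "\<gamma>22 = \<gamma>" "\<gamma>12 = complex_of_real \<gamma>"
    using pos eq \<gamma>12 by (simp_all add: \<gamma>_def)
  obtain e where e: "\<epsilon> = complex_of_real e" using \<epsilon> by (auto elim: Reals_cases)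
  interpret decoherence_free_solution hbar \<omega>\<^sub>0 e \<gamma> \<rho>
    using hbar rates sol init by unfold_locales (simp_all add: e)
  define x where "x = exp (- \<gamma> * t)"
  have "16 / \<eta> \<le> t * (\<gamma> + \<gamma>)"
    using t pos unfolding rates(2,3) by (simp only: pos_divide_le_eq)
  then have \<gamma>t: "8 / \<eta> \<le> \<gamma> * t" by (simp add: algebra_simps)
  have "8 / \<eta> > 0" using assms by simp
  then have "\<gamma> * t > 0" using \<gamma>t by linarith
  then have t0: "t \<ge> 0" using rates(1) by (simp add: zero_less_mult_iff)
  have "8 / \<eta> < exp (\<gamma> * t)"
    using \<gamma>t exp_ge_add_one_self[of "\<gamma> * t"] by linarith
  moreover have "exp (\<gamma> * t) = 1 / x" by (simp add: x_def exp_minus field_simps)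
  moreover have x: "0 < x" "x \<le> 1" using \<open>\<gamma> * t > 0\<close> by (auto simp: x_def)
  ultimately have x\<eta>: "8 * x < \<eta>" using assms by (simp add: field_simps)
  have x2: "x\<^sup>2 \<le> x" using x by (simp add: power2_eq_square mult_left_le_one_le)
  have "within_tolerance \<eta> (\<rho> t) ((1/2) *\<^sub>C proj \<psi>_G + (1/2) *\<^sub>C proj \<psi>_A)"
  proof -
    have "4 * exp (- \<gamma> * t) < \<eta>" using x x\<eta> unfolding x_def by linarith
    from asymptotic_distance[OF t0 this] show ?thesis unfolding asymptotic_state_def .
  qed
  moreover have "\<bar>prob_energy (\<rho> t) - 1/2\<bar> < \<eta>"
  proof -
    have "prob_energy (\<rho> t) - 1/2 = x\<^sup>2 / 2"
      unfolding prob_energy_eq[OF t0, folded x_def] by (simp add: field_simps)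
    moreover have "0 \<le> x\<^sup>2" by simp
    ultimately show ?thesis using x x2 x\<eta> by linarith
  qed
  moreover have "no_photon_prob X > 0 \<and>
      ptrace_snd (no_photon_part X) = one_excitation_part (\<rho> t) \<and>
      within_tolerance \<eta> (no_photon_state X) (tensor (proj \<psi>_A) (proj (ket {#}))) \<and>
      within_tolerance \<eta> (ptrace_snd (no_photon_state X)) (proj \<psi>_A) \<and>
      uncorrelated (no_photon_state X)"
    if X: "ptrace_snd X = \<rho> t" "captures_lost_excitations X" for X :: "(jc \<times> 'k multiset) op"
  proof -
    define p where "p = no_photon_prob X"
    define \<sigma> where "\<sigma> = complex_of_real (1 / p) *\<^sub>C one_excitation_part (\<rho> t)"
    have p: "p = Re (\<rho> t E0 E0 + \<rho> t G1 G1)"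
      unfolding p_def no_photon_prob_captured[OF X(2)] X(1) by simp
    have p_eq: "p = (1 + x\<^sup>2) / 2"
      unfolding p excited_population[OF t0] x_def by (rule Re_complex_of_real)
    have "1 + x\<^sup>2 > 0" by (intro add_pos_nonneg) simp_all
    then have p_pos: "p > 0" unfolding p_eq by (rule half_gt_zero)
    have part: "no_photon_part X = tensor (one_excitation_part (\<rho> t)) (proj (ket {#}))"
      using no_photon_part_captured[OF X(2)] X(1) by simp
    have state: "no_photon_state X = tensor \<sigma> (proj (ket {#}))"
      unfolding no_photon_state_def part op_scale_tensor \<sigma>_def p_def by simp
    have close: "within_tolerance \<eta> \<sigma> (proj \<psi>_A)"
      unfolding \<sigma>_def by (rule conditional_distance[OF t0 _ p]) (use x x\<eta> in \<open>unfold x_def, linarith\<close>)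
    \<comment> \<open>The conditional state is \<sigma> tensored with the vacuum, and its marginals
      are \<sigma> and the trace of \<sigma> times the vacuum projection. Being uncorrelated
      therefore amounts to trace 1 and holds exactly, not just within the tolerance.\<close>
    have "op_trace \<sigma> = complex_of_real (1 / p) * op_trace (one_excitation_part (\<rho> t))"
      unfolding \<sigma>_def op_trace_def op_scale_def by (rule infsum_cmult_right')
    also have "\<dots> = complex_of_real (1 / p * p)"
      unfolding op_trace_one_excitation_part excited_population[OF t0] p_eq x_def of_real_mult ..
    finally have "op_trace \<sigma> = 1" using p_pos by simp
    then have "uncorrelated (no_photon_state X)"
      unfolding uncorrelated_def state ptrace_snd_tensor_proj ptrace_fst_tensor
      by (simp add: op_scale_def)
    moreover have "within_tolerance \<eta> (no_photon_state X) (tensor (proj \<psi>_A) (proj (ket {#})))"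
      unfolding state by (rule within_tolerance_tensor_proj[OF close])
    ultimately show ?thesis
      using p_pos close by (simp add: p_def part state ptrace_snd_tensor_proj)
  qed
  ultimately show "within_tolerance \<eta> (\<rho> t) ((1/2) *\<^sub>C proj \<psi>_G + (1/2) *\<^sub>C proj \<psi>_A) \<and>
        \<bar>prob_energy (\<rho> t) - 1/2\<bar> < \<eta> \<and>
        (\<forall>X::(jc \<times> 'k multiset) op.
           density_op X \<longrightarrow> ptrace_snd X = \<rho> t \<longrightarrow> captures_lost_excitations X \<longrightarrow>
             no_photon_prob X > 0 \<and>
             ptrace_snd (no_photon_part X) = one_excitation_part (\<rho> t) \<and>
             within_tolerance \<eta> (no_photon_state X) (tensor (proj \<psi>_A) (proj (ket {#}))) \<and>
             within_tolerance \<eta> (ptrace_snd (no_photon_state X)) (proj \<psi>_A) \<and>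
             uncorrelated (no_photon_state X)) \<and>
        maximally_entangled \<psi>_A \<and> antisymmetric \<psi>_A"
    using maximally_entangled_\<psi>_A antisymmetric_\<psi>_A by blast
qed

end
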